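(* For real $k>0$ let $T_k:[0,1]\to[0,1]$ be the map $T_kx=\dfrac{1}{1+x^k}$, and let $k_0\approx4.125$ be the solution of $k_0=1+k_0^{k_0/(k_0+1)}$. (i) For $k<k_0$ the map $T_k$ has a fixed point $u_k$ which attracts all of $[0,1]$, and there are no other periodic orbits. (ii) For $k>k_0$ the map $T_k$ has a repelling fixed point $u_k$, an attracting periodic orbit $\{p_1,p_2\}$ (of period $2$) which attracts all of $[0,1]\setminus\{u_k\}$, and no other periodic orbits.
   Context: The parameter $k$ ranges over positive real numbers, not necessarily integers. The paper writes the map on the simplex $K_1=\{(x,y):x\ge0,\ y\ge0,\ x+y=1\}$, identified with $[0,1]$ via $(x,1-x)\leftrightarrow x$. A fixed point $u$ attracts $x$ if $T_k^nx\to u$; a periodic orbit attracts $x$ if the distance from $T_k^nx$ to the orbit tends to $0$. The fixed point $u$ is repelling if $|T_k'(u)|>1$.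
   Formalization: The printed value k_0≈4.125 is not accurate to its digits (the solution of the equation is about 4.141); the formal theorem states only |k_0 − 4.125| < 1/40, with k_0 defined as the unique positive solution of the equation. *)

theory Defs
  imports "HOL-Analysis.Analysis" "HOL-Combinatorics.Orbits"
begin

definition T :: "real \<Rightarrow> real \<Rightarrow> real" where
  "T k x = 1 / (1 + x powr k)"

(* T k is a total function; only its restriction to {0..1} is used, and the library's 0 powr k = 0
   is the right value there for k > 0. *)
lemma T_in_unit_interval: "T k x \<in> {0..1}"
  by (simp add: T_def field_simps add_pos_nonneg)

(* A description that is meaningful only together with the existence and uniqueness of the solution,
   both of which the theorem asserts. *)
definition k0 :: real where
  "k0 = (THE k. 0 < k \<and> k = 1 + k powr (k / (k + 1)))"

(* The library's cyclic_on f P says that P = {f s, f (f s), ...} for some s in P, so P is the forward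
   orbit of a periodic point; the period is the cardinality of P, and fixed points give singletons. *)
definition periodic_orbits_on :: "'a set \<Rightarrow> ('a \<Rightarrow> 'a) \<Rightarrow> 'a set set" where
  "periodic_orbits_on S f = {P. P \<subseteq> S \<and> cyclic_on f P}"

definition fixed_point_attracts :: "('a::metric_space \<Rightarrow> 'a) \<Rightarrow> 'a \<Rightarrow> 'a \<Rightarrow> bool" where
  "fixed_point_attracts f u x \<longleftrightarrow> f u = u \<and> (\<lambda>n. (f ^^ n) x) \<longlonglongrightarrow> u"

definition orbit_attracts :: "('a::metric_space \<Rightarrow> 'a) \<Rightarrow> 'a set \<Rightarrow> 'a \<Rightarrow> bool" where
  "orbit_attracts f P x \<longleftrightarrow> cyclic_on f P \<and> (\<lambda>n. infdist ((f ^^ n) x) P) \<longlonglongrightarrow> 0"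

definition attracting_orbit_on :: "'a::metric_space set \<Rightarrow> ('a \<Rightarrow> 'a) \<Rightarrow> 'a set \<Rightarrow> bool" where
  "attracting_orbit_on S f P \<longleftrightarrow> P \<in> periodic_orbits_on S f \<and>
     (\<exists>U. open U \<and> P \<subseteq> U \<and> (\<forall>x \<in> U \<inter> S. orbit_attracts f P x))"

(* The derivative at an end point of S is one-sided. *)
definition repelling_fixed_point_on :: "real set \<Rightarrow> (real \<Rightarrow> real) \<Rightarrow> real \<Rightarrow> bool" where
  "repelling_fixed_point_on S f u \<longleftrightarrow> u \<in> S \<and> f u = u \<and>
     (\<exists>D. (f has_real_derivative D) (at u within S) \<and> \<bar>D\<bar> > 1)"

end

theory Submission
  imports Defs
begin

text \<open>
  The map \<open>T k\<close> is decreasing, so \<open>T k \<circ> T k\<close> is increasing and its orbits converge to its fixed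
  points. Taking logarithms in \<open>T x = T\<^sup>-\<^sup>1 x\<close>, these are the zeros of
  \<open>psi k x = ln x - ln (1 - x) - k ln (1 + x\<^sup>k)\<close>. The derivative of \<open>psi k\<close> has the sign of
  \<open>x\<^sup>-\<^sup>k + 1 - k\<^sup>2 (1 - x)\<close>, which is strictly convex. Hence \<open>psi k\<close> has at most three zeros, and its
  derivative is negative at the middle one of three. The fixed point \<open>u\<close> of \<open>T k\<close> lies between the
  points of a 2-cycle, so a 2-cycle exists exactly if \<open>|T' u| = k (1 - u) > 1\<close>, and then it is unique.
  Since \<open>(k + 1) ln x - ln (1 - x)\<close> increases in \<open>x\<close> and vanishes at \<open>u\<close>, the condition \<open>u < 1 - 1/k\<close>
  says that \<open>(k + 1) ln (k - 1) - k ln k > 0\<close>; the left-hand side increases in \<open>k\<close> and vanishes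
  at \<open>k0\<close>.
\<close>

subsection \<open>Attraction and periodic orbits\<close>

text \<open>The distance to \<open>c\<close> serves as a Lyapunov function. It decreases along the
  orbit to a limit \<open>L\<close>; a subsequential limit \<open>y\<close> and its image
  \<open>f y\<close> both lie at distance \<open>L\<close> from \<open>c\<close>, so strict decrease
  forces \<open>y = c\<close>.\<close>

lemma funpow_tendsto_of_dist_decreasing:
  fixes f :: "'a::metric_space \<Rightarrow> 'a"
  assumes "compact S" and cont: "continuous_on S f" and inv: "\<And>x. x \<in> S \<Longrightarrow> f x \<in> S"
    and dec: "\<And>x. \<lbrakk>x \<in> S; x \<noteq> c\<rbrakk> \<Longrightarrow> dist (f x) c < dist x c" and "f c = c" and "x \<in> S"
  shows "(\<lambda>n. (f ^^ n) x) \<longlonglongrightarrow> c"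
proof -
  let ?x = "\<lambda>n. (f ^^ n) x"
  have mem: "?x n \<in> S" for n
    using \<open>x \<in> S\<close> by (induction n) (auto intro: inv)
  have "decseq (\<lambda>n. dist (?x n) c)"
  proof (rule decseq_SucI)
    show "dist (?x (Suc n)) c \<le> dist (?x n) c" for n
      using dec[OF mem, of n] \<open>f c = c\<close> by (cases "?x n = c") simp_all
  qed
  then obtain L where L: "(\<lambda>n. dist (?x n) c) \<longlonglongrightarrow> L"
    using decseq_convergent[of "\<lambda>n. dist (?x n) c" 0] zero_le_dist by blast
  obtain y r where y: "y \<in> S" "strict_mono (r :: nat \<Rightarrow> nat)" "(?x \<circ> r) \<longlonglongrightarrow> y"
    using \<open>compact S\<close>[unfolded compact_def, rule_format, of ?x] mem by blast
  have "(\<lambda>n. dist (?x (r n)) c) \<longlonglongrightarrow> dist y c"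
    using tendsto_dist[OF y(3) tendsto_const] by (simp add: o_def)
  moreover have "(\<lambda>n. dist (?x (r n)) c) \<longlonglongrightarrow> L"
    using LIMSEQ_subseq_LIMSEQ[OF L y(2)] by (simp add: o_def)
  ultimately have Ly: "dist y c = L"
    by (rule LIMSEQ_unique)
  have "(\<lambda>n. f (?x (r n))) \<longlonglongrightarrow> f y"
    using continuous_on_tendsto_compose[OF cont y(3) y(1)] mem by (simp add: o_def)
  then have "(\<lambda>n. dist (f (?x (r n))) c) \<longlonglongrightarrow> dist (f y) c"
    by (intro tendsto_dist tendsto_const)
  moreover have "(\<lambda>n. dist (f (?x (r n))) c) \<longlonglongrightarrow> L"
    using LIMSEQ_subseq_LIMSEQ[OF LIMSEQ_Suc[OF L] y(2)] by (simp add: o_def)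
  ultimately have "dist (f y) c = L"
    by (rule LIMSEQ_unique)
  with Ly dec[OF y(1)] \<open>f c = c\<close> have "L = 0"
    by (metis dist_self less_irrefl)
  with L show ?thesis
    by (subst tendsto_dist_iff) simp
qed

text \<open>Even iterates tend to \<open>a\<close>, hence odd ones to \<open>f a\<close> by
  continuity. This carries convergence under the increasing map \<open>T k \<circ> T k\<close> back
  to \<open>T k\<close>.\<close>

lemma infdist_orbit_tendsto:
  fixes f :: "'a::metric_space \<Rightarrow> 'a"
  assumes cont: "continuous_on S f" and inv: "\<And>x. x \<in> S \<Longrightarrow> f x \<in> S" and "x \<in> S" "a \<in> S"
    and lim: "(\<lambda>n. ((f \<circ> f) ^^ n) x) \<longlonglongrightarrow> a"
  shows "(\<lambda>n. infdist ((f ^^ n) x) {a, f a}) \<longlonglongrightarrow> 0"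
proof -
  have eq: "(f \<circ> f) ^^ n = f ^^ (2 * n)" for n
    using funpow_mult[where f=f and m=2 and n=n] by (simp add: numeral_2_eq_2)
  have mem: "(f ^^ n) x \<in> S" for n
    using \<open>x \<in> S\<close> by (induction n) (auto intro: inv)
  have even: "(\<lambda>n. (f ^^ (2 * n)) x) \<longlonglongrightarrow> a"
    using lim by (simp add: eq)
  then have odd: "(\<lambda>n. (f ^^ (2 * n + 1)) x) \<longlonglongrightarrow> f a"
    using continuous_on_tendsto_compose[OF cont even \<open>a \<in> S\<close>] mem by simp
  show ?thesis
  proof (rule LIMSEQ_I)
    fix e :: real assume "e > 0"
    obtain N where N: "\<And>n. n \<ge> N \<Longrightarrow> dist ((f ^^ (2 * n)) x) a < e"
      using even \<open>e > 0\<close> unfolding lim_sequentially by blast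
    obtain M where M: "\<And>n. n \<ge> M \<Longrightarrow> dist ((f ^^ (2 * n + 1)) x) (f a) < e"
      using odd \<open>e > 0\<close> unfolding lim_sequentially by blast
    have "infdist ((f ^^ n) x) {a, f a} < e" if "n \<ge> 2 * (N + M) + 1" for n
    proof (cases "even n")
      case True
      then obtain j where "n = 2 * j" by blast
      with that N[of j] infdist_le[of a "{a, f a}" "(f ^^ n) x"] show ?thesis
        by auto
    next
      case False
      then obtain j where "n = 2 * j + 1" by (blast elim: oddE)
      with that M[of j] infdist_le[of "f a" "{a, f a}" "(f ^^ n) x"] show ?thesis
        by auto
    qed
    then show "\<exists>no. \<forall>n\<ge>no. norm (infdist ((f ^^ n) x) {a, f a} - 0) < e"
      by (auto simp: infdist_nonneg)
  qed
qed

text \<open>The case \<open>f a = a\<close> is included, so fixed points and 2-cycles are treated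
  alike.\<close>

lemma cyclic_on_two_cycle:
  assumes "f (f a) = a"
  shows "cyclic_on f {a, f a}"
proof -
  have "orbit f a = {(f ^^ m) a |m. m < 2}"
    by (rule orbit_altdef_bounded) (simp_all add: assms numeral_2_eq_2)
  also have "\<dots> = {a, f a}"
    by (auto simp: less_2_cases_iff intro: exI[of _ 0] exI[of _ 1])
  finally show ?thesis
    unfolding cyclic_on_def by blast
qed

text \<open>Along multiples of its period \<open>s\<close> stands still, so its distance to
  \<open>Q\<close> is constant and thus 0. Cyclic sets sharing a point coincide. Attraction thereby
  excludes further periodic orbits.\<close>

lemma periodic_orbit_attracted_eq:
  fixes f :: "'a::metric_space \<Rightarrow> 'a"
  assumes P: "cyclic_on f P" "s \<in> P" and Q: "orbit_attracts f Q s" "closed Q"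
  shows "P = Q"
proof -
  from P have P_eq: "P = orbit f s" and "s \<in> orbit f s"
    unfolding cyclic_on_alldef by blast+
  then obtain m where m: "m > 0" "(f ^^ m) s = s"
    by (auto simp: orbit_altdef)
  have per: "(f ^^ (m * n)) s = s" for n
    using m(2) by (induction n) (auto simp: funpow_add)
  have "strict_mono (\<lambda>n. m * n)"
    using m(1) by (simp add: strict_mono_def)
  from LIMSEQ_subseq_LIMSEQ[OF _ this, of "\<lambda>n. infdist ((f ^^ n) s) Q" 0] Q(1)
  have "(\<lambda>n::nat. infdist s Q) \<longlonglongrightarrow> 0"
    by (simp add: o_def per orbit_attracts_def)
  then have "infdist s Q = 0"
    by (simp add: LIMSEQ_const_iff)
  moreover have "Q \<noteq> {}" "cyclic_on f Q"
    using Q(1) unfolding orbit_attracts_def cyclic_on_alldef by blast+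
  ultimately have "s \<in> Q"
    using Q(2) by (simp add: in_closed_iff_infdist_zero)
  with \<open>cyclic_on f Q\<close> P_eq show ?thesis
    unfolding cyclic_on_alldef by blast
qed

lemma orbit_attracts_of_image:
  assumes "orbit_attracts f P (f x)"
  shows "orbit_attracts f P x"
proof -
  have "(\<lambda>n. infdist ((f ^^ Suc n) x) P) \<longlonglongrightarrow> 0"
    using assms by (simp add: orbit_attracts_def funpow_Suc_right del: funpow.simps)
  then have "(\<lambda>n. infdist ((f ^^ n) x) P) \<longlonglongrightarrow> 0"
    by (rule LIMSEQ_imp_Suc)
  with assms show ?thesis
    by (simp add: orbit_attracts_def)
qed

subsection \<open>The map \<open>T k\<close>\<close>

lemma continuous_on_T: "k > 0 \<Longrightarrow> continuous_on {0..1} (T k)"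
  unfolding T_def
  \<comment> \<open>At 0 the base of the power vanishes, and continuity there rests on
    \<open>k > 0\<close>.\<close>
  by (intro continuous_intros continuous_on_powr') (auto simp: add_nonneg_eq_0_iff)

lemma T_less: "\<lbrakk>k > 0; 0 \<le> x; x < y\<rbrakk> \<Longrightarrow> T k y < T k x"
  unfolding T_def
  by (intro divide_strict_left_mono mult_pos_pos add_pos_nonneg) (auto intro: powr_less_mono2)

lemma T_antimono: "\<lbrakk>k > 0; 0 \<le> x; x \<le> y\<rbrakk> \<Longrightarrow> T k y \<le> T k x"
  using T_less[of k x y] by (cases "x = y") auto

lemma T_has_derivative:
  assumes "x > 0"
  shows "(T k has_real_derivative - (k * x powr (k - 1) / (1 + x powr k)\<^sup>2)) (at x)"
proof -
  have "1 + x powr k > 0" by (simp add: add_pos_nonneg)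
  then show ?thesis
    unfolding T_def using assms
    by (auto intro!: derivative_eq_intros simp: power2_eq_square)
qed

lemma T_fixed_point_exists:
  assumes "k > 0"
  obtains u where "0 < u" "u < 1" "T k u = u"
proof -
  have "continuous_on {0..1} (\<lambda>x. x - T k x)"
    by (intro continuous_intros continuous_on_T assms)
  then obtain u where u: "0 \<le> u" "u \<le> 1" "u - T k u = 0"
    using IVT'[of "\<lambda>x. x - T k x" 0 0 1] by (auto simp: T_def)
  \<comment> \<open>The values are \<open>T k 0 = 1\<close> and \<open>T k 1 = 1 / 2\<close>, so the
    fixed point is interior.\<close>
  moreover have "0 - T k 0 \<noteq> 0" "1 - T k 1 \<noteq> 0" by (simp_all add: T_def)
  ultimately have "u \<noteq> 0" "u \<noteq> 1" by blast+
  with u show ?thesis by (intro that[of u]) simp_all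
qed

lemma T_nonneg: "0 \<le> T k x"
  using T_in_unit_interval[of k x] by simp

lemma continuous_on_TT:
  assumes "k > 0"
  shows "continuous_on {0..1} (T k \<circ> T k)"
  using continuous_on_T[OF assms] T_in_unit_interval
  by (intro continuous_on_compose) (auto intro: continuous_on_subset)

lemma TT_mono: "\<lbrakk>k > 0; 0 \<le> x; x \<le> y\<rbrakk> \<Longrightarrow> T k (T k x) \<le> T k (T k y)"
  by (rule T_antimono[OF _ T_nonneg T_antimono])

lemma TT_fixed_pos: "T k (T k x) = x \<Longrightarrow> x > 0"
  by (metis T_def add_pos_nonneg powr_ge_zero zero_less_divide_1_iff zero_less_one)

subsection \<open>Counting the fixed points of \<open>T k \<circ> T k\<close>\<close>

text \<open>With \<open>y = T k x\<close> this is \<open>k * ln y - ln ((1 - x) / x)\<close>; the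
  equation \<open>T k y = x\<close> says \<open>y powr k = (1 - x) / x\<close>.\<close>

definition psi :: "real \<Rightarrow> real \<Rightarrow> real" where
  "psi k x = ln x - ln (1 - x) - k * ln (1 + x powr k)"

definition slope :: "real \<Rightarrow> real \<Rightarrow> real" where
  "slope k x = x powr (- k) + 1 - k\<^sup>2 * (1 - x)"

context
  fixes k :: real
  assumes k_pos: "k > 0"
begin

lemma psi_eq_0_iff:
  assumes "0 < x" "x < 1"
  shows "T k (T k x) = x \<longleftrightarrow> psi k x = 0"
proof -
  define y where "y = T k x"
  have "y > 0" by (simp add: y_def T_def add_pos_nonneg)
  have "T k y = x \<longleftrightarrow> y powr k = (1 - x) / x"
    using assms by (auto simp: T_def field_simps add_nonneg_eq_0_iff)
  also have "\<dots> \<longleftrightarrow> ln (y powr k) = ln ((1 - x) / x)"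
    using assms \<open>y > 0\<close> by (subst ln_inj_iff) auto
  also have "\<dots> \<longleftrightarrow> psi k x = 0"
    using assms \<open>y > 0\<close>
    by (auto simp: psi_def ln_powr ln_div y_def T_def add_pos_nonneg)
  finally show ?thesis by (simp add: y_def)
qed

text \<open>Only signs and zeros of the derivative matter later, so the positive factor
  \<open>c\<close> stays existential.\<close>

lemma psi_has_derivative:
  assumes "0 < x" "x < 1"
  shows "\<exists>c > 0. (psi k has_real_derivative c * slope k x) (at x)"
proof (intro exI conjI)
  let ?c = "x powr k / (x * (1 - x) * (1 + x powr k))"
  have pos: "1 + x powr k > 0" by (simp add: add_pos_nonneg)
  show "?c > 0" using assms pos by simp
  have "(psi k has_real_derivative
      1 / x + 1 / (1 - x) - k * (k * x powr (k - 1) / (1 + x powr k))) (at x)"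
    unfolding psi_def using assms pos
    by (auto intro!: derivative_eq_intros simp: divide_simps)
  moreover have "1 / x + 1 / (1 - x) - k * (k * x powr (k - 1) / (1 + x powr k)) = ?c * slope k x"
  proof -
    have "x powr k * x powr (- k) = 1" "x powr (k - 1) = x powr k / x"
      using assms by (simp_all add: powr_minus powr_diff)
    then show ?thesis
      using assms pos unfolding slope_def
      by (simp add: divide_simps) (simp add: algebra_simps power2_eq_square)
  qed
  ultimately show "(psi k has_real_derivative ?c * slope k x) (at x)" by simp
qed

lemma psi_Rolle:
  assumes "0 < l" "l < r" "r < 1" "psi k l = 0" "psi k r = 0"
  obtains z where "l < z" "z < r" "slope k z = 0"
proof -
  have D: "\<exists>c>0. (psi k has_real_derivative c * slope k x) (at x)" if "l \<le> x" "x \<le> r" for x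
    using psi_has_derivative[of x] that \<open>0 < l\<close> \<open>r < 1\<close> by auto
  have "continuous_on {l..r} (psi k)"
  proof (rule DERIV_atLeastAtMost_imp_continuous_on)
    show "\<exists>y. DERIV (psi k) x :> y" if "l \<le> x" "x \<le> r" for x
      using D[OF that] by blast
  qed
  moreover have "psi k differentiable (at x)" if "l < x" "x < r" for x
    using D[of x] that by (auto simp: real_differentiable_def)
  ultimately obtain z where z: "l < z" "z < r" "DERIV (psi k) z :> 0"
    using Rolle[of l r "psi k"] assms(2,4,5) by auto
  moreover obtain c where "c > 0" "DERIV (psi k) z :> c * slope k z"
    using D[of z] z by auto
  ultimately have "slope k z = 0"
    using DERIV_unique by fastforce
  with z that show ?thesis by blast
qed

text \<open>Strict convexity by two mean values: if \<open>slope k x\<close> were nonnegative, the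
  derivative would be nonnegative somewhere before \<open>x\<close>, hence positive everywhere
  after, and \<open>slope k\<close> could not return to 0 at \<open>d\<close>.\<close>

lemma slope_neg_between_zeros:
  assumes "0 < c" "c < x" "x < d" "slope k c = 0" "slope k d = 0"
  shows "slope k x < 0"
proof (rule ccontr)
  assume nonneg: "\<not> ?thesis"
  have deriv: "DERIV (slope k) z :> k\<^sup>2 - k * z powr (- k - 1)" if "z > 0" for z
    unfolding slope_def using that by (auto intro!: derivative_eq_intros)
  obtain v where v: "c < v" "v < x" "slope k x - slope k c = (x - c) * (k\<^sup>2 - k * v powr (- k - 1))"
    using MVT2[OF \<open>c < x\<close> deriv] assms(1) by force
  obtain w where w: "x < w" "w < d" "slope k d - slope k x = (d - x) * (k\<^sup>2 - k * w powr (- k - 1))"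
    using MVT2[OF \<open>x < d\<close> deriv] assms(1,2) by force
  have "w powr (- k - 1) < v powr (- k - 1)"
    using v w assms k_pos by (intro powr_less_mono2_neg) auto
  then have less: "k\<^sup>2 - k * v powr (- k - 1) < k\<^sup>2 - k * w powr (- k - 1)"
    using k_pos by simp
  have "(x - c) * (k\<^sup>2 - k * v powr (- k - 1)) \<ge> 0"
    using v(3) nonneg assms by simp
  then have "k\<^sup>2 - k * v powr (- k - 1) \<ge> 0"
    using assms by (simp add: zero_le_mult_iff)
  with less have "(d - x) * (k\<^sup>2 - k * w powr (- k - 1)) > 0"
    using assms by simp
  with w(3) nonneg assms show False by simp
qed

text \<open>Rolle puts a zero of \<open>slope k\<close> on each side of \<open>x\<close>.\<close>

lemma slope_neg_between_psi_zeros: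
  assumes "0 < a" "a < x" "x < b" "b < 1" "psi k a = 0" "psi k x = 0" "psi k b = 0"
  shows "slope k x < 0"
proof -
  obtain c where "a < c" "c < x" "slope k c = 0" by (rule psi_Rolle[of a x]) (use assms in auto)
  moreover obtain d where "x < d" "d < b" "slope k d = 0" by (rule psi_Rolle[of x b]) (use assms in auto)
  ultimately show ?thesis
    using slope_neg_between_zeros[of c x d] assms by simp
qed

text \<open>Rolle would give three zeros of \<open>slope k\<close>, the middle one contradicting
  negativity between the outer two.\<close>

lemma psi_no_four_zeros:
  assumes "0 < a" "a < b" "b < c" "c < d" "d < 1"
    and "psi k a = 0" "psi k b = 0" "psi k c = 0" "psi k d = 0"
  shows False
proof -
  obtain x where "a < x" "x < b" "slope k x = 0" by (rule psi_Rolle[of a b]) (use assms in auto)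
  moreover obtain y where "b < y" "y < c" "slope k y = 0" by (rule psi_Rolle[of b c]) (use assms in auto)
  moreover obtain z where "c < z" "z < d" "slope k z = 0" by (rule psi_Rolle[of c d]) (use assms in auto)
  ultimately show ?thesis
    using slope_neg_between_zeros[of x y z] assms by simp
qed

end

subsection \<open>Dynamics of \<open>T k\<close>\<close>

context
  fixes k u :: real
  assumes k_pos: "k > 0" and u: "0 < u" "u < 1" and fixed: "T k u = u"
begin

section \<open>The multiplier at the fixed point\<close>

lemma fixed_powr: "u powr k = (1 - u) / u"
proof -
  have "1 + u powr k > 0" by (simp add: add_pos_nonneg)
  with fixed have "u * (1 + u powr k) = 1"
    unfolding T_def by (metis nonzero_eq_divide_eq order_less_irrefl)
  with u show ?thesis by (simp add: field_simps)
qed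

lemma T_has_derivative_fixed: "(T k has_real_derivative - (k * (1 - u))) (at u)"
proof -
  have "u powr (k - 1) = (1 - u) / u\<^sup>2"
    using u by (simp add: powr_diff fixed_powr power2_eq_square)
  moreover have "1 + u powr k = 1 / u"
    using u by (simp add: fixed_powr field_simps)
  ultimately have "k * u powr (k - 1) / (1 + u powr k)\<^sup>2 = k * (1 - u)"
    using u by (simp add: power2_eq_square)
  with T_has_derivative[OF u(1), of k] show ?thesis
    by simp
qed

text \<open>With \<open>m = k * (1 - u)\<close>, eliminating \<open>u powr k\<close> turns
  \<open>slope k u\<close> into \<open>(1 - m\<^sup>2) / (1 - u)\<close>.\<close>

lemma multiplier_gt_1_of_slope_neg:
  assumes "slope k u < 0"
  shows "k * (1 - u) > 1"
proof -
  have "u powr (- k) = u / (1 - u)"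
    by (simp add: powr_minus fixed_powr)
  then have "slope k u = (1 - (k * (1 - u))\<^sup>2) / (1 - u)"
    using u by (simp add: slope_def field_simps power2_eq_square)
  with assms u have "(1::real)\<^sup>2 < (k * (1 - u))\<^sup>2"
    by (simp add: divide_less_0_iff)
  then show ?thesis
    using k_pos u by (intro power2_less_imp_less[of 1]) auto
qed

section \<open>Two-cycles around the fixed point and their attraction\<close>

lemma T_gt_fixed: "\<lbrakk>0 \<le> x; x < u\<rbrakk> \<Longrightarrow> u < T k x"
  using T_less[OF k_pos, of x u] by (simp add: fixed)

lemma T_lt_fixed: "u < x \<Longrightarrow> T k x < u"
  using T_less[OF k_pos, of u x] u by (simp add: fixed)

lemma two_cycle_bounds:
  assumes "0 \<le> x" "x < u" "T k (T k x) = x"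
  shows "0 < x" "u < T k x" "T k x < 1"
    and "psi k x = 0" "psi k u = 0" "psi k (T k x) = 0"
proof -
  show pos: "0 < x" and gt: "u < T k x"
    using TT_fixed_pos[OF assms(3)] T_gt_fixed assms by auto
  show lt: "T k x < 1"
    using T_less[OF k_pos, of 0 x] pos by (simp add: T_def)
  have "T k (T k u) = u" by (simp add: fixed)
  moreover have "T k (T k (T k x)) = T k x" by (simp add: assms(3))
  ultimately show "psi k x = 0" "psi k u = 0" "psi k (T k x) = 0"
    using psi_eq_0_iff[OF k_pos, of x] psi_eq_0_iff[OF k_pos, of u] psi_eq_0_iff[OF k_pos, of "T k x"]
      pos gt lt u assms by simp_all
qed

text \<open>A 2-cycle would make \<open>u\<close> the middle one of three zeros of
  \<open>psi k\<close>, forcing a multiplier above 1.\<close>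

lemma no_two_cycle:
  assumes "k * (1 - u) \<le> 1" "0 \<le> x" "x < u"
  shows "T k (T k x) \<noteq> x"
proof
  assume "T k (T k x) = x"
  note * = two_cycle_bounds[OF assms(2,3) this]
  have "slope k u < 0"
    using slope_neg_between_psi_zeros[OF k_pos *(1) assms(3) *(2,3)] * by simp
  with multiplier_gt_1_of_slope_neg assms(1) show False by simp
qed

text \<open>Two such points \<open>x < y\<close> would give four zeros
  \<open>x < y < u < T k x\<close> of \<open>psi k\<close>.\<close>

lemma two_cycle_unique:
  assumes x: "0 \<le> x" "x < u" "T k (T k x) = x" and y: "0 \<le> y" "y < u" "T k (T k y) = y"
  shows "x = y"
proof -
  have False if "0 \<le> x" "x < y" "y < u" "T k (T k x) = x" "T k (T k y) = y" for x y
  proof -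
    have "x < u" "0 \<le> y" using that by simp_all
    note * = two_cycle_bounds[OF that(1) this(1) that(4)]
    show False
      using psi_no_four_zeros[OF k_pos *(1) that(2,3) *(2,3)] *
        two_cycle_bounds[OF \<open>0 \<le> y\<close> that(3,5)] by simp
  qed
  from this[of x y] this[of y x] x y show ?thesis by (cases x y rule: linorder_cases) auto
qed

text \<open>At \<open>u\<close> the derivative of \<open>T k \<circ> T k\<close> is the squared
  multiplier, which exceeds 1, so the graph runs below the diagonal just left of \<open>u\<close>.
  At 0 it is not below, and \<open>a\<close> is a crossing in between.\<close>

lemma two_cycle_exists:
  assumes "k * (1 - u) > 1"
  obtains a where "0 \<le> a" "a < u" "T k (T k a) = a"
    and "\<And>x. \<lbrakk>a < x; x < u\<rbrakk> \<Longrightarrow> T k (T k x) < x"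
proof -
  let ?F = "\<lambda>x. T k (T k x) - x"
  have cont: "continuous_on {l..r} ?F" if "0 \<le> l" "r \<le> 1" for l r
    using continuous_on_subset[OF continuous_on_TT[OF k_pos], of "{l..r}"] that
    by (intro continuous_intros) (auto simp: o_def)
  have "DERIV (T k \<circ> T k) u :> - (k * (1 - u)) * - (k * (1 - u))"
    using T_has_derivative_fixed by (intro DERIV_chain) (simp_all add: fixed)
  then have "DERIV ?F u :> (k * (1 - u))\<^sup>2 - 1"
    by (intro DERIV_diff) (simp_all add: o_def power2_eq_square)
  moreover have "(k * (1 - u))\<^sup>2 - 1 > 0"
    using assms by (simp add: power2_eq_square less_1_mult)
  ultimately obtain d where d: "d > 0" "\<And>h. \<lbrakk>h > 0; h < d\<rbrakk> \<Longrightarrow> ?F (u - h) < ?F u"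
    using DERIV_pos_inc_left by blast
  have left: "\<exists>y. x < y \<and> y < u \<and> ?F y < 0" if "x < u" for x
  proof (intro exI conjI)
    let ?h = "min (d / 2) ((u - x) / 2)"
    show "x < u - ?h" "u - ?h < u" using that d(1) by (auto simp: min_def field_simps)
    show "?F (u - ?h) < 0" using d(2)[of ?h] d(1) that fixed by (simp add: min_def)
  qed
  obtain y where y: "0 < y" "y < u" "?F y < 0" using left[of 0] u by auto
  have "?F 0 \<ge> 0" using T_nonneg by simp
  then obtain a where a: "0 \<le> a" "a \<le> y" "?F a = 0"
    using IVT2'[of ?F y 0 0] y cont u by (auto simp del: diff_ge_0_iff_ge)
  show ?thesis
  proof (rule that[of a])
    show "0 \<le> a" "a < u" "T k (T k a) = a" using a y by simp_all
    fix x assume x: "a < x" "x < u"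
    show "T k (T k x) < x"
    proof (rule ccontr)
      assume "\<not> ?thesis"
      then have "?F x \<ge> 0" by simp
      \<comment> \<open>A point below the diagonal between \<open>x\<close> and \<open>u\<close>
        yields a crossing to the right of \<open>a\<close>, against uniqueness.\<close>
      obtain y where y: "x < y" "y < u" "?F y < 0" using left[OF x(2)] by blast
      then obtain z where z: "x \<le> z" "z \<le> y" "?F z = 0"
        using IVT2'[of ?F y 0 x] \<open>?F x \<ge> 0\<close> cont[of x y] x a u by auto
      then have "z = a"
        using two_cycle_unique[of z a] a x y \<open>a < u\<close> by simp
      with z x show False by simp
    qed
  qed
qed

text \<open>Below \<open>a\<close> the map \<open>T k \<circ> T k\<close> moves points up, between
  \<open>a\<close> and \<open>u\<close> down, and monotonicity prevents overshooting
  \<open>a\<close>. The choice \<open>a = u\<close> covers the attracting fixed point,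
  \<open>a < u\<close> the 2-cycle.\<close>

lemma orbit_attracts_two_cycle:
  assumes a: "0 \<le> a" "a \<le> u" "T k (T k a) = a"
    and below: "\<And>x. \<lbrakk>0 \<le> x; x < a\<rbrakk> \<Longrightarrow> T k (T k x) \<noteq> x"
    and above: "\<And>x. \<lbrakk>a < x; x < u\<rbrakk> \<Longrightarrow> T k (T k x) < x"
    and x: "x \<in> {0..1}" "x \<noteq> u \<or> a = u"
  shows "orbit_attracts (T k) {a, T k a} x"
proof -
  have left: "orbit_attracts (T k) {a, T k a} x" if x: "0 \<le> x" "x \<le> u" "x \<noteq> u \<or> a = u" for x
  proof -
    \<comment> \<open>The interval \<open>{0..m}\<close> is compact and invariant, and for
      \<open>a < u\<close> it leaves out the fixed point \<open>u\<close>, where strict decrease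
      fails.\<close>
    define m where "m = max a x"
    have m: "0 \<le> m" "m < u \<or> a = u" "a \<le> m" "m \<le> u" using a x by (auto simp: m_def)
    have lt: "y < T k (T k y)" if y: "0 \<le> y" "y < a" for y
    proof (rule ccontr)
      assume "\<not> ?thesis"
      moreover have "continuous_on {0..y} (\<lambda>x. T k (T k x) - x)"
        using continuous_on_subset[OF continuous_on_TT[OF k_pos], of "{0..y}"] y a u
        by (intro continuous_intros) (auto simp: o_def)
      ultimately obtain z where z: "0 \<le> z" "z \<le> y" "T k (T k z) - z = 0"
        using IVT2'[of "\<lambda>x. T k (T k x) - x" y 0 0] y T_nonneg[of k "T k 0"] by auto
      with below[of z] y show False by simp
    qed
    have dec: "dist (T k (T k y)) a < dist y a" if y: "0 \<le> y" "y \<le> m" "y \<noteq> a" for y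
    proof (cases "y < a")
      case True
      with lt[of y] TT_mono[OF k_pos, of y a] a y show ?thesis by (simp add: dist_real_def)
    next
      case False
      with y have "a < y" by simp
      with above[of y] TT_mono[OF k_pos, of a y] a y m show ?thesis by (auto simp: dist_real_def)
    qed
    have "(\<lambda>n. ((T k \<circ> T k) ^^ n) x) \<longlonglongrightarrow> a"
    proof (rule funpow_tendsto_of_dist_decreasing[of "{0..m}"])
      show "continuous_on {0..m} (T k \<circ> T k)"
        using continuous_on_TT[OF k_pos] m u by (auto intro: continuous_on_subset)
      show "(T k \<circ> T k) y \<in> {0..m}" if "y \<in> {0..m}" for y
      proof (cases "y \<le> a")
        case True
        with TT_mono[OF k_pos, of y a] a that m T_nonneg show ?thesis by auto
      next
        case False
        with above[of y] that m T_nonneg show ?thesis by auto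
      qed
    qed (use a x dec in \<open>auto simp: m_def\<close>)
    then have "(\<lambda>n. infdist ((T k ^^ n) x) {a, T k a}) \<longlonglongrightarrow> 0"
      by (rule infdist_orbit_tendsto[OF continuous_on_T[OF k_pos], rotated 3])
        (use a x u T_in_unit_interval in auto)
    with cyclic_on_two_cycle[of "T k" a] a show ?thesis
      by (simp add: orbit_attracts_def)
  qed
  show ?thesis
  proof (cases "x \<le> u")
    case True
    with left x show ?thesis by simp
  next
    case False
    \<comment> \<open>Points right of \<open>u\<close> land left of it after one step.\<close>
    then have "T k x < u" by (intro T_lt_fixed) simp
    with left[of "T k x"] T_nonneg show ?thesis
      by (intro orbit_attracts_of_image[of _ _ x]) simp
  qed
qed

section \<open>The stable and the unstable regime\<close>

lemma cyclic_on_fixed_singleton: "cyclic_on (T k) {u}"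
  using cyclic_on_two_cycle[of "T k" u] by (simp add: fixed)

lemma stable_case:
  assumes "k * (1 - u) \<le> 1"
  shows "\<forall>x \<in> {0..1}. fixed_point_attracts (T k) u x"
    and "periodic_orbits_on {0..1} (T k) = {{u}}"
proof -
  have attr: "orbit_attracts (T k) {u} x" if "x \<in> {0..1}" for x
    \<comment> \<open>For \<open>a = u\<close> the condition between \<open>a\<close> and
      \<open>u\<close> is vacuous and the cycle collapses to \<open>{u}\<close>.\<close>
    using orbit_attracts_two_cycle[of u x] no_two_cycle[OF assms] that u by (simp add: fixed)
  then show "\<forall>x \<in> {0..1}. fixed_point_attracts (T k) u x"
    unfolding fixed_point_attracts_def orbit_attracts_def
    by (subst tendsto_dist_iff) (simp add: fixed)
  have "P = {u}" if "P \<subseteq> {0..1}" "cyclic_on (T k) P" for P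
  proof -
    from that obtain s where "s \<in> P" unfolding cyclic_on_def by blast
    with that attr show ?thesis
      by (intro periodic_orbit_attracted_eq[of "T k" P s]) auto
  qed
  then show "periodic_orbits_on {0..1} (T k) = {{u}}"
    using cyclic_on_fixed_singleton u unfolding periodic_orbits_on_def by auto
qed

lemma unstable_case:
  assumes "k * (1 - u) > 1"
  shows "repelling_fixed_point_on {0..1} (T k) u"
    and "\<exists>p1 p2. p1 \<noteq> p2
            \<and> attracting_orbit_on {0..1} (T k) {p1, p2}
            \<and> (\<forall>x \<in> {0..1} - {u}. orbit_attracts (T k) {p1, p2} x)
            \<and> periodic_orbits_on {0..1} (T k) = {{u}, {p1, p2}}"
proof -
  show "repelling_fixed_point_on {0..1} (T k) u"
    unfolding repelling_fixed_point_on_def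
    using u fixed assms T_has_derivative_fixed[THEN has_field_derivative_at_within, of "{0..1}"]
    by force
  obtain a where a: "0 \<le> a" "a < u" "T k (T k a) = a"
    and above: "\<And>x. \<lbrakk>a < x; x < u\<rbrakk> \<Longrightarrow> T k (T k x) < x"
    using two_cycle_exists[OF assms] by blast
  let ?P = "{a, T k a}"
  have gt: "u < T k a" using T_gt_fixed a by simp
  have below: "T k (T k x) \<noteq> x" if "0 \<le> x" "x < a" for x
    using two_cycle_unique[of x a] that a by auto
  have attr: "orbit_attracts (T k) ?P x" if "x \<in> {0..1} - {u}" for x
    using orbit_attracts_two_cycle[of a x] a below above that by auto
  have P: "?P \<in> periodic_orbits_on {0..1} (T k)"
    using cyclic_on_two_cycle[of "T k" a] a u T_in_unit_interval
    by (auto simp: periodic_orbits_on_def)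
  have only: "P = {u} \<or> P = ?P" if "P \<subseteq> {0..1}" "cyclic_on (T k) P" for P
  proof (cases "u \<in> P")
    case True
    with that(2) cyclic_on_fixed_singleton show ?thesis
      unfolding cyclic_on_alldef by blast
  next
    case False
    from that obtain s where "s \<in> P" unfolding cyclic_on_def by blast
    with that False have "s \<in> {0..1} - {u}" by blast
    with that \<open>s \<in> P\<close> attr have "P = ?P"
      by (intro periodic_orbit_attracted_eq[of "T k" P s]) auto
    then show ?thesis ..
  qed
  show "\<exists>p1 p2. p1 \<noteq> p2
            \<and> attracting_orbit_on {0..1} (T k) {p1, p2}
            \<and> (\<forall>x \<in> {0..1} - {u}. orbit_attracts (T k) {p1, p2} x)
            \<and> periodic_orbits_on {0..1} (T k) = {{u}, {p1, p2}}"
  proof (intro exI conjI)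
    show "a \<noteq> T k a" using gt a by simp
    \<comment> \<open>The whole complement of \<open>u\<close> serves as the attracted
      neighbourhood.\<close>
    have "open (- {u})" "?P \<subseteq> - {u}" using gt a by auto
    then show "attracting_orbit_on {0..1} (T k) ?P"
      unfolding attracting_orbit_on_def using P attr by blast
    show "\<forall>x \<in> {0..1} - {u}. orbit_attracts (T k) ?P x"
      using attr by blast
    show "periodic_orbits_on {0..1} (T k) = {{u}, ?P}"
    proof (intro equalityI subsetI)
      show "Q \<in> {{u}, ?P}" if "Q \<in> periodic_orbits_on {0..1} (T k)" for Q
        using only[of Q] that by (simp add: periodic_orbits_on_def)
      show "Q \<in> periodic_orbits_on {0..1} (T k)" if "Q \<in> {{u}, ?P}" for Q
        using that P cyclic_on_fixed_singleton u by (auto simp: periodic_orbits_on_def)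
    qed
  qed
qed

end

subsection \<open>The threshold \<open>k0\<close>\<close>

text \<open>The equation \<open>k - 1 = k powr (k / (k + 1))\<close> in logarithms, multiplied by
  \<open>k + 1\<close>.\<close>

definition excess :: "real \<Rightarrow> real" where
  "excess k = (k + 1) * ln (k - 1) - k * ln k"

lemma excess_strict_mono:
  assumes "1 < x" "x < y"
  shows "excess x < excess y"
proof (rule DERIV_pos_imp_increasing[OF \<open>x < y\<close>])
  fix k assume "x \<le> k" "k \<le> y"
  then have k: "k > 1" using assms by simp
  show "\<exists>D. DERIV excess k :> D \<and> D > 0"
  proof (intro exI conjI)
    show "DERIV excess k :> ln (k - 1) + (k + 1) / (k - 1) - (ln k + 1)"
      unfolding excess_def using k by (auto intro!: derivative_eq_intros)
    \<comment> \<open>The derivative equals \<open>2 / (k - 1) - ln (k / (k - 1))\<close>; this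
      bound on the logarithm leaves at least \<open>1 / (k - 1)\<close>.\<close>
    have "ln (k / (k - 1)) \<le> k / (k - 1) - 1"
      using k by (intro ln_le_minus_one) simp
    then have "ln k - ln (k - 1) \<le> 1 / (k - 1)"
      using k by (simp add: ln_div field_simps)
    moreover have "(k + 1) / (k - 1) = 1 + 1 / (k - 1) + 1 / (k - 1)"
      using k by (simp add: field_simps)
    moreover have "1 / (k - 1) > 0" using k by simp
    ultimately show "ln (k - 1) + (k + 1) / (k - 1) - (ln k + 1) > 0"
      by linarith
  qed
qed

lemma excess_eq_0_iff:
  assumes "k > 0"
  shows "k = 1 + k powr (k / (k + 1)) \<longleftrightarrow> k > 1 \<and> excess k = 0"
proof (cases "k > 1")
  case True
  have "k = 1 + k powr (k / (k + 1)) \<longleftrightarrow> k - 1 = k powr (k / (k + 1))"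
    by auto
  also have "\<dots> \<longleftrightarrow> ln (k - 1) = ln (k powr (k / (k + 1)))"
    using True by (subst ln_inj_iff) auto
  also have "\<dots> \<longleftrightarrow> excess k = 0"
    using True by (simp add: excess_def ln_powr field_simps)
  finally show ?thesis using True by simp
next
  case False
  \<comment> \<open>Positivity of the power rules out solutions with
    \<open>k \<le> 1\<close>.\<close>
  moreover have "k powr (k / (k + 1)) > 0" using assms by simp
  ultimately show ?thesis by linarith
qed

text \<open>The point 4.1 is \<open>4.125 - 1 / 40\<close>. Multiplying by 10 clears the fractional
  coefficients and leaves a comparison of rational powers.\<close>

lemma excess_neg: "excess 4.1 < 0"
proof -
  have "ln ((3.1::real) ^ 51) < ln (4.1 ^ 41)"
    by (subst ln_less_cancel_iff) (simp_all add: field_simps)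
  then have "51 * ln (3.1::real) < 41 * ln 4.1"
    by (subst (asm) (1 2) ln_realpow) simp_all
  then show ?thesis
    by (simp add: excess_def)
qed

text \<open>The other end, \<open>4.125 + 1 / 40\<close>, with the factor 20 since 4.15 is
  \<open>83 / 20\<close>.\<close>

lemma excess_pos: "excess 4.15 > 0"
proof -
  have "ln ((4.15::real) ^ 83) < ln (3.15 ^ 103)"
    by (subst ln_less_cancel_iff) (simp_all add: field_simps)
  then have "83 * ln (4.15::real) < 103 * ln 3.15"
    by (subst (asm) (1 2) ln_realpow) simp_all
  then show ?thesis
    by (simp add: excess_def)
qed

lemma ex1_excess_zero: "\<exists>!k. k > 1 \<and> excess k = 0"
proof -
  have "continuous_on {4.1..4.15} excess"
    unfolding excess_def by (intro continuous_intros) auto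
  then obtain k where "4.1 \<le> k" "excess k = 0"
    using IVT'[of excess "4.1" 0 "4.15"] excess_neg excess_pos by auto
  then have k: "k > 1 \<and> excess k = 0" by simp
  then show ?thesis
  proof (rule ex1I)
    show "l = k" if "l > 1 \<and> excess l = 0" for l
      using that k excess_strict_mono[of l k] excess_strict_mono[of k l]
      by (cases l k rule: linorder_cases) auto
  qed
qed

lemma ex1_k0_equation: "\<exists>!k::real. 0 < k \<and> k = 1 + k powr (k / (k + 1))"
proof -
  have "0 < k \<and> k = 1 + k powr (k / (k + 1)) \<longleftrightarrow> k > 1 \<and> excess k = 0" for k
    using excess_eq_0_iff[of k] by auto
  with ex1_excess_zero show ?thesis by presburger
qed

lemma k0_excess: "k0 > 1" "excess k0 = 0"
  using theI'[OF ex1_k0_equation] excess_eq_0_iff[of k0] unfolding k0_def by auto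

lemma excess_pos_iff: "k > 1 \<Longrightarrow> excess k > 0 \<longleftrightarrow> k > k0"
  using k0_excess excess_strict_mono[of k k0] excess_strict_mono[of k0 k]
  by (cases k k0 rule: linorder_cases) auto

lemma k0_bounds: "4.1 < k0" "k0 < 4.15"
  using excess_pos_iff[of "4.1"] excess_pos_iff[of "4.15"] excess_neg excess_pos k0_excess
  by (cases "k0 = 4.1"; simp)+

lemma multiplier_gt_1_iff:
  assumes "k > 0" "0 < u" "u < 1" "T k u = u"
  shows "k * (1 - u) > 1 \<longleftrightarrow> k > k0"
proof (cases "k > 1")
  case False
  then have "k * (1 - u) \<le> 1 * 1"
    using assms by (intro mult_mono) auto
  with False k0_excess show ?thesis by auto
next
  case True
  \<comment> \<open>The fixed point equation reads \<open>u powr (k + 1) = 1 - u\<close>;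
    \<open>h\<close> is the difference of the logarithms of its two sides.\<close>
  define h where "h x = (k + 1) * ln x - ln (1 - x)" for x :: real
  have h_mono: "h x < h y" if "0 < x" "x < y" "y < 1" for x y
  proof -
    have "(k + 1) * ln x < (k + 1) * ln y" "ln (1 - y) < ln (1 - x)"
      using that assms by simp_all
    then show ?thesis by (simp add: h_def)
  qed
  \<comment> \<open>The critical position, where \<open>k * (1 - w) = 1\<close>; comparing
    \<open>h\<close> at \<open>u\<close> and \<open>w\<close> locates \<open>u\<close> without
    solving for it.\<close>
  define w where "w = (k - 1) / k"
  have w: "0 < w" "w < 1" using True by (auto simp: w_def)
  have "1 - w = 1 / k" using True by (simp add: w_def field_simps)
  then have "ln (1 - w) = - ln k"
    using True by (simp add: ln_div)
  then have "h w = excess k"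
    using True by (simp add: h_def excess_def w_def ln_div algebra_simps)
  moreover have "h u = 0"
  proof -
    have "1 - u = u powr (k + 1)"
      using assms(2) fixed_powr[OF assms] by (simp add: powr_add)
    then show ?thesis
      using assms by (simp add: h_def ln_powr)
  qed
  moreover have "k * (1 - u) > 1 \<longleftrightarrow> u < w"
    using True by (auto simp: w_def field_simps)
  moreover have "u < w \<longleftrightarrow> h u < h w"
    using h_mono[of u w] h_mono[of w u] w assms by (cases u w rule: linorder_cases) auto
  ultimately show ?thesis
    using excess_pos_iff[OF True] by simp
qed

theorem theorem5p1:
  shows "(\<exists>!k::real. 0 < k \<and> k = 1 + k powr (k / (k + 1)))
    \<and> \<bar>k0 - 4.125\<bar> < 1 / 40
    \<and> (\<forall>k::real. 0 < k \<and> k < k0 \<longrightarrow>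
         (\<exists>u \<in> {0..1}. T k u = u
            \<and> (\<forall>x \<in> {0..1}. fixed_point_attracts (T k) u x)
            \<and> periodic_orbits_on {0..1} (T k) = {{u}}))
    \<and> (\<forall>k::real. k > k0 \<longrightarrow>
         (\<exists>u p1 p2. repelling_fixed_point_on {0..1} (T k) u
            \<and> p1 \<noteq> p2
            \<and> attracting_orbit_on {0..1} (T k) {p1, p2}
            \<and> (\<forall>x \<in> {0..1} - {u}. orbit_attracts (T k) {p1, p2} x)
            \<and> periodic_orbits_on {0..1} (T k) = {{u}, {p1, p2}}))"
proof (intro conjI allI impI)
  show "\<exists>!k::real. 0 < k \<and> k = 1 + k powr (k / (k + 1))"
    by (rule ex1_k0_equation)
  show "\<bar>k0 - 4.125\<bar> < 1 / 40"
    unfolding abs_less_iff using k0_bounds by simp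
next
  fix k :: real assume k: "0 < k \<and> k < k0"
  then obtain u where u: "0 < u" "u < 1" "T k u = u"
    using T_fixed_point_exists by blast
  then have "k * (1 - u) \<le> 1"
    using multiplier_gt_1_iff[of k u] k by simp
  with stable_case[of k u] k u show "\<exists>u \<in> {0..1}. T k u = u
            \<and> (\<forall>x \<in> {0..1}. fixed_point_attracts (T k) u x)
            \<and> periodic_orbits_on {0..1} (T k) = {{u}}"
    by (intro bexI[of _ u] conjI) simp_all
next
  fix k :: real assume k: "k > k0"
  with k0_excess have "k > 0" by simp
  then obtain u where u: "0 < u" "u < 1" "T k u = u"
    using T_fixed_point_exists by blast
  then have "k * (1 - u) > 1"
    using multiplier_gt_1_iff[of k u] k \<open>k > 0\<close> by simp
  with unstable_case[of k u] \<open>k > 0\<close> u show "\<exists>u p1 p2. repelling_fixed_point_on {0..1} (T k) u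
            \<and> p1 \<noteq> p2
            \<and> attracting_orbit_on {0..1} (T k) {p1, p2}
            \<and> (\<forall>x \<in> {0..1} - {u}. orbit_attracts (T k) {p1, p2} x)
            \<and> periodic_orbits_on {0..1} (T k) = {{u}, {p1, p2}}"
    by blast
qed

end
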